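(* Let $L\in U_{ad}$ and let $\{x_t\}$ be the state process generated by the feedback matrix $L$. Then for each $t\in\mathbb{N}$ (including $t=0$), $x_t$ is a sub-Gaussian random vector: for all $u\in\mathbb{R}^n$ with $\|u\|_2=1$, $$\big\|\langle u,x_t-\mathbb{E}[x_t]\rangle\big\|_{L^p}\le\sigma_t(L)\sqrt p,\qquad\forall p\ge1,$$ where $$\sigma_t(L)=\big[4K(1+\|L\|)\big]^t\big(\sigma_0+2\|\mathbb{E}[x_0]\|_2\big).$$
   Context: Let $n,m\ge 1$. $(A_t,B_t,Q_t,R_t)_{t\ge1}$ are i.i.d. random matrices, $A_t\in\mathbb{R}^{n\times n}$, $B_t\in\mathbb{R}^{n\times m}$, $Q_t\in\mathbb{R}^{n\times n}$ and $R_t\in\mathbb{R}^{m\times m}$ symmetric positive semidefinite; $(A,B,Q,R)$ denotes a generic copy. $x_0$ is a random vector in $\mathbb{R}^n$ independent of $(A_t,B_t,Q_t,R_t)_{t\ge 1}$. $\|\cdot\|$ is the operator norm, $\|\cdot\|_2$ the Euclidean norm, $\|\xi\|_{L^p}=(\mathbb{E}|\xi|^p)^{1/p}$. Standing assumptions: $\mathbb{E}\|x_0\|_2^2,\mathbb{E}\|A\|^2,\mathbb{E}\|B\|^2,\mathbb{E}\|Q\|,\mathbb{E}\|R\|<\infty$; $\mathbb{E}[Q]$, $\mathbb{E}[R]$ and $\mathbb{E}[x_0x_0^\top]$ are positive definite; $U_{ad}\ne\emptyset$, where $\mathcal{F}_L(X)=\mathbb{E}[(A-BL)X(A-BL)^\top]$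 on real symmetric $n\times n$ matrices and $U_{ad}=\{L\in\mathbb{R}^{m\times n}:\rho(\mathcal{F}_L)<1\}$ ($\rho$ = spectral radius). Moreover $\|\langle u,x_0-\mathbb{E}[x_0]\rangle\|_{L^p}\le\sigma_0\sqrt p$ for all $p\ge1$ and all unit vectors $u\in\mathbb{R}^n$, and $\max\{\|A\|,\|B\|,\|Q\|,\|R\|\}\le K$ almost surely, with $K>0$ a constant. The state process generated by $L$ is $x_{t+1}=(A_{t+1}-B_{t+1}L)x_t$ started at $x_0$. *)

theory Defs
  imports "HOL-Probability.Probability"
begin

text \<open>The operator norm of a matrix induced by the Euclidean norms.  The \<open>norm\<close> that
  HOL-Analysis puts on a matrix type is the Frobenius norm.\<close>

definition opnorm :: "real^'n^'m \<Rightarrow> real" where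
  "opnorm A = onorm ((*v) A)"

definition sym_matrices :: "(real^'n^'n) set" where
  "sym_matrices = {X. transpose X = X}"

definition psd :: "real^'n^'n \<Rightarrow> bool" where
  "psd X \<longleftrightarrow> X \<in> sym_matrices \<and> (\<forall>v. 0 \<le> v \<bullet> (X *v v))"

definition pos_def :: "real^'n^'n \<Rightarrow> bool" where
  "pos_def X \<longleftrightarrow> X \<in> sym_matrices \<and> (\<forall>v. v \<noteq> 0 \<longrightarrow> 0 < v \<bullet> (X *v v))"

definition outer :: "real^'n \<Rightarrow> real^'n^'n" where
  "outer x = (\<chi> i j. x $ i * x $ j)"

text \<open>Complex eigenvalues of a real-linear map \<open>T\<close> that preserves a real subspace \<open>S\<close>,
  i.e. the eigenvalues of the complexification of \<open>T\<close>: the equation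
  \<open>T X + \<i> T Y = \<lambda> (X + \<i> Y)\<close> with \<open>X + \<i> Y \<noteq> 0\<close>, split into real and imaginary parts.\<close>

definition eigenvalues_on :: "'v::real_vector set \<Rightarrow> ('v \<Rightarrow> 'v) \<Rightarrow> complex set" where
  "eigenvalues_on S T = {z. \<exists>X\<in>S. \<exists>Y\<in>S. (X \<noteq> 0 \<or> Y \<noteq> 0) \<and>
     T X = Re z *\<^sub>R X - Im z *\<^sub>R Y \<and> T Y = Im z *\<^sub>R X + Re z *\<^sub>R Y}"

text \<open>Intended for finite-dimensional \<open>S \<noteq> {0}\<close>, where the set of eigenvalues is finite and
  nonempty, so that the supremum is a maximum.\<close>

definition spectral_radius_on :: "'v::real_vector set \<Rightarrow> ('v \<Rightarrow> 'v) \<Rightarrow> real" where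
  "spectral_radius_on S T = (SUP z\<in>eigenvalues_on S T. cmod z)"

definition F_op :: "'w measure \<Rightarrow> ('w \<Rightarrow> real^'n^'n) \<Rightarrow> ('w \<Rightarrow> real^'m^'n) \<Rightarrow>
    real^'n^'m \<Rightarrow> real^'n^'n \<Rightarrow> real^'n^'n" where
  "F_op M A B L X = (LINT \<omega>|M. (A \<omega> - B \<omega> ** L) ** X ** transpose (A \<omega> - B \<omega> ** L))"

definition U_ad :: "'w measure \<Rightarrow> ('w \<Rightarrow> real^'n^'n) \<Rightarrow> ('w \<Rightarrow> real^'m^'n) \<Rightarrow> (real^'n^'m) set" where
  "U_ad M A B = {L. spectral_radius_on sym_matrices (F_op M A B L) < 1}"

primrec state :: "(nat \<Rightarrow> 'w \<Rightarrow> real^'n^'n) \<Rightarrow> (nat \<Rightarrow> 'w \<Rightarrow> real^'m^'n) \<Rightarrow> real^'n^'m \<Rightarrow>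
    ('w \<Rightarrow> real^'n) \<Rightarrow> nat \<Rightarrow> 'w \<Rightarrow> real^'n" where
  "state A B L x0 0 = x0"
| "state A B L x0 (Suc t) = (\<lambda>\<omega>. (A (Suc t) \<omega> - B (Suc t) \<omega> ** L) *v state A B L x0 t \<omega>)"

definition Lp_norm :: "'w measure \<Rightarrow> real \<Rightarrow> ('w \<Rightarrow> real) \<Rightarrow> real" where
  "Lp_norm M p \<xi> = (LINT \<omega>|M. \<bar>\<xi> \<omega>\<bar> powr p) powr (1 / p)"

text \<open>The bound \<open>\<parallel>\<xi>\<parallel>\<^sub>L\<^sub>p \<le> c\<close> includes finiteness of the \<open>p\<close>-th moment, which has to be stated
  separately because the Bochner integral of a non-integrable function is \<open>0\<close>.\<close>

definition sub_gaussian :: "'w measure \<Rightarrow> ('w \<Rightarrow> real^'n) \<Rightarrow> real \<Rightarrow> bool" where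
  "sub_gaussian M X \<sigma> \<longleftrightarrow> X \<in> borel_measurable M \<and>
     (\<forall>u p. norm u = 1 \<longrightarrow> 1 \<le> p \<longrightarrow>
        integrable M (\<lambda>\<omega>. \<bar>u \<bullet> (X \<omega> - (LINT \<omega>'|M. X \<omega>'))\<bar> powr p) \<and>
        Lp_norm M p (\<lambda>\<omega>. u \<bullet> (X \<omega> - (LINT \<omega>'|M. X \<omega>'))) \<le> \<sigma> * sqrt p)"

definition iid_seq :: "'w measure \<Rightarrow> (nat \<Rightarrow> 'w \<Rightarrow> 'b::topological_space) \<Rightarrow> bool" where
  "iid_seq M Z \<longleftrightarrow> prob_space.indep_vars M (\<lambda>_. borel) Z {1..} \<and>
     (\<forall>t\<ge>1. distr M borel (Z t) = distr M borel (Z 1))"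

text \<open>Independence of a random variable and the whole process \<open>(Z\<^sub>t)\<^bsub>t \<ge> 1\<^esub>\<close>, as independence of
  the generated \<open>\<sigma>\<close>-algebras; \<open>indep_var\<close> requires both variables to have the same type.\<close>

definition indep_of_seq ::
    "'w measure \<Rightarrow> ('w \<Rightarrow> 'a::topological_space) \<Rightarrow> (nat \<Rightarrow> 'w \<Rightarrow> 'b::topological_space) \<Rightarrow> bool" where
  "indep_of_seq M X Z \<longleftrightarrow> prob_space.indep_set M
     (sets (vimage_algebra (space M) X borel))
     (sets (vimage_algebra (space M) (\<lambda>\<omega>. \<lambda>t\<in>{1..}. Z t \<omega>) (PiM {1..} (\<lambda>_. borel))))"

end

theory Submission
  imports Defs
begin

text \<open>Write \<open>C = A\<^bsub>t+1\<^esub> - B\<^bsub>t+1\<^esub> L\<close>, whose operator norm is at most \<open>c = K (1 + \<parallel>L\<parallel>)\<close>, and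
  \<open>m = E x\<^sub>t\<close>.  For a unit vector \<open>u\<close> the random vector \<open>v = C\<^sup>T u\<close> is independent of \<open>x\<^sub>t\<close> and bounded
  by \<open>c\<close>, and the centered \<open>\<langle>u, x\<^bsub>t+1\<^esub>\<rangle> = \<langle>v, x\<^sub>t\<rangle>\<close> equals \<open>\<langle>v, x\<^sub>t - m\<rangle> + \<langle>v - E v, m\<rangle>\<close>.  Conditioning on
  \<open>v\<close> (Fubini) bounds the \<open>L\<^sup>p\<close> norm of the first summand by \<open>c \<sigma> \<surd>p\<close>; the second is at most
  \<open>2 c \<parallel>m\<parallel>\<close>.  Since \<open>\<parallel>E x\<^sub>t\<parallel> \<le> c\<^sup>t \<parallel>E x\<^sub>0\<parallel>\<close>, induction gives the sharper constant
  \<open>c\<^sup>t (\<sigma>\<^sub>0 + 2 t \<parallel>E x\<^sub>0\<parallel>)\<close>.\<close>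


section \<open>Moment estimates: a bounded perturbation, and inner products of independent
  vectors\<close>

text \<open>Convexity of the power function is invoked for positive \<open>a\<close> and
  \<open>b\<close> only. If one of them is 0, the claim reduces to \<open>k powr p \<le> k\<close>
  for \<open>k\<close> between 0 and 1.\<close>

lemma powr_convex_combination:
  fixes a b l p :: real
  assumes "0 \<le> a" "0 \<le> b" "0 \<le> l" "l \<le> 1" "1 \<le> p"
  shows "(l * a + (1 - l) * b) powr p \<le> l * a powr p + (1 - l) * b powr p"
proof -
  have shrink: "(k * z) powr p \<le> k * z powr p" if "0 \<le> k" "k \<le> 1" "0 \<le> z" for k z :: real
  proof -
    have "k powr p \<le> k"
      using powr_mono'[of 1 p k] that assms(5) by simp
    then show ?thesis
      using that by (simp add: powr_mult mult_right_mono)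
  qed
  consider "a = 0" | "b = 0" | "0 < a" "0 < b"
    using assms by linarith
  then show ?thesis
  proof cases
    case 1
    then show ?thesis using shrink[of "1 - l" b] assms by simp
  next
    case 2
    then show ?thesis using shrink[of l a] assms by simp
  next
    case 3
    then show ?thesis
      using convex_onD[OF powr_convex[OF assms(5)], of l b a] assms
      by (simp add: add.commute)
  qed
qed

text \<open>Minkowski's inequality for an essentially bounded second summand, in terms of moments: a
  pointwise convexity estimate is integrated, so that integrability comes out along with the bound.
  Positivity of \<open>a\<close> allows dividing by it.\<close>

lemma (in prob_space) moment_add_bounded:
  fixes f g :: "'a \<Rightarrow> real"
  assumes [measurable]: "f \<in> borel_measurable M" "g \<in> borel_measurable M"
    and "1 \<le> p" "0 < a" "0 \<le> b"
    and int: "integrable M (\<lambda>\<omega>. \<bar>f \<omega>\<bar> powr p)"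
    and le: "(LINT \<omega>|M. \<bar>f \<omega>\<bar> powr p) \<le> a powr p"
    and g: "AE \<omega> in M. \<bar>g \<omega>\<bar> \<le> b"
  shows "integrable M (\<lambda>\<omega>. \<bar>f \<omega> + g \<omega>\<bar> powr p)"
    and "(LINT \<omega>|M. \<bar>f \<omega> + g \<omega>\<bar> powr p) \<le> (a + b) powr p"
proof -
  define l where "l = a / (a + b)"
  have l: "0 \<le> l" "l \<le> 1" "1 - l = b / (a + b)"
    using assms by (auto simp: l_def field_simps)
  \<comment> \<open>\<open>|f| + b\<close> is \<open>a + b\<close> times a convex combination of \<open>|f| / a\<close> and \<open>1\<close>.\<close>
  let ?h = "\<lambda>\<omega>. (a + b) powr p * (l * (\<bar>f \<omega>\<bar> powr p / a powr p) + (1 - l))"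
  have bound: "AE \<omega> in M. \<bar>f \<omega> + g \<omega>\<bar> powr p \<le> ?h \<omega>"
    using g
  proof eventually_elim
    case (elim \<omega>)
    have "(a + b) * l = a" "(a + b) * (1 - l) = b"
      using assms(4,5) unfolding l(3) by (auto simp: l_def)
    then have "(a + b) * (l * (\<bar>f \<omega>\<bar> / a) + (1 - l) * 1) = \<bar>f \<omega>\<bar> + b"
      using assms(4) by (simp only: distrib_left mult.assoc[symmetric]) simp
    then have "\<bar>f \<omega> + g \<omega>\<bar> \<le> (a + b) * (l * (\<bar>f \<omega>\<bar> / a) + (1 - l) * 1)"
      using elim by linarith
    then have "\<bar>f \<omega> + g \<omega>\<bar> powr p \<le> ((a + b) * (l * (\<bar>f \<omega>\<bar> / a) + (1 - l) * 1)) powr p"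
      using \<open>1 \<le> p\<close> by (intro powr_mono2) auto
    also have "\<dots> = (a + b) powr p * (l * (\<bar>f \<omega>\<bar> / a) + (1 - l) * 1) powr p"
      using assms(4,5) l by (subst powr_mult) auto
    also have "\<dots> \<le> (a + b) powr p * (l * (\<bar>f \<omega>\<bar> / a) powr p + (1 - l) * 1 powr p)"
      using assms(3,4) l by (intro mult_left_mono powr_convex_combination) auto
    finally show ?case
      using assms(4) by (simp add: powr_divide)
  qed
  have inth: "integrable M ?h"
    using int by simp
  show int': "integrable M (\<lambda>\<omega>. \<bar>f \<omega> + g \<omega>\<bar> powr p)"
    by (rule Bochner_Integration.integrable_bound[OF inth]) (use bound in \<open>auto elim!: eventually_mono\<close>)
  have "(LINT \<omega>|M. \<bar>f \<omega> + g \<omega>\<bar> powr p) \<le> (LINT \<omega>|M. ?h \<omega>)"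
    by (rule integral_mono_AE[OF int' inth bound])
  also have "\<dots> = (a + b) powr p * (l * ((LINT \<omega>|M. \<bar>f \<omega>\<bar> powr p) / a powr p) + (1 - l))"
    using int by (simp add: prob_space)
  also have "\<dots> \<le> (a + b) powr p * (l * 1 + (1 - l))"
    using le \<open>0 < a\<close> l by (intro mult_left_mono add_right_mono) auto
  finally show "(LINT \<omega>|M. \<bar>f \<omega> + g \<omega>\<bar> powr p) \<le> (a + b) powr p"
    by simp
qed

text \<open>Taking \<open>p\<close>-th powers is monotone on nonnegative reals. The equivalence
  holds for infinite moments too, where both sides refer to the default integral 0; integrability is
  therefore always established separately.\<close>

lemma Lp_norm_le_iff:
  assumes "0 < p" "0 \<le> s"
  shows "Lp_norm M p \<xi> \<le> s \<longleftrightarrow> (LINT \<omega>|M. \<bar>\<xi> \<omega>\<bar> powr p) \<le> s powr p"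
proof -
  let ?I = "LINT \<omega>|M. \<bar>\<xi> \<omega>\<bar> powr p"
  have "0 \<le> ?I" by simp
  then have eq: "(?I powr (1 / p)) powr p = ?I"
    using assms by (simp add: powr_powr)
  have "?I powr (1 / p) \<le> s \<longleftrightarrow> (?I powr (1 / p)) powr p \<le> s powr p"
    using assms by (metis powr_ge_zero powr_less_mono2 powr_mono2 less_imp_le not_le)
  then show ?thesis
    by (simp add: Lp_norm_def eq)
qed

text \<open>The case \<open>a = 0\<close> is reached by applying the moment bound to
  \<open>a + e\<close> and letting \<open>e\<close> tend to 0.\<close>

lemma (in prob_space) Lp_norm_add_bounded:
  fixes f g :: "'a \<Rightarrow> real"
  assumes [measurable]: "f \<in> borel_measurable M" "g \<in> borel_measurable M"
    and "1 \<le> p" "0 \<le> a" "0 \<le> b"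
    and int: "integrable M (\<lambda>\<omega>. \<bar>f \<omega>\<bar> powr p)"
    and le: "Lp_norm M p f \<le> a"
    and g: "AE \<omega> in M. \<bar>g \<omega>\<bar> \<le> b"
  shows "integrable M (\<lambda>\<omega>. \<bar>f \<omega> + g \<omega>\<bar> powr p)"
    and "Lp_norm M p (\<lambda>\<omega>. f \<omega> + g \<omega>) \<le> a + b"
proof -
  have *: "(LINT \<omega>|M. \<bar>f \<omega>\<bar> powr p) \<le> (a + e) powr p" if "0 < e" for e
    using le that assms by (subst Lp_norm_le_iff[symmetric]) auto
  show "integrable M (\<lambda>\<omega>. \<bar>f \<omega> + g \<omega>\<bar> powr p)"
    \<comment> \<open>Integrability does not depend on the size of the bound, so any positive
      constant above \<open>a\<close> will do.\<close>
    by (rule moment_add_bounded(1)[of f g p "a + 1" b]) (use assms * in auto)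
  show "Lp_norm M p (\<lambda>\<omega>. f \<omega> + g \<omega>) \<le> a + b"
  proof (rule field_le_epsilon)
    fix e :: real assume "0 < e"
    then have "(LINT \<omega>|M. \<bar>f \<omega> + g \<omega>\<bar> powr p) \<le> ((a + e) + b) powr p"
      by (intro moment_add_bounded(2)) (use assms * in auto)
    then show "Lp_norm M p (\<lambda>\<omega>. f \<omega> + g \<omega>) \<le> a + b + e"
      using assms \<open>0 < e\<close> by (subst Lp_norm_le_iff) (auto simp: algebra_simps)
  qed
qed

text \<open>By independence the joint law of \<open>v\<close> and \<open>x\<close> is a product, so
  Fubini lets \<open>v\<close> be frozen at a value \<open>w\<close>; the resulting moment bound is
  then averaged over the law of \<open>v\<close>.\<close>

lemma (in prob_space) Lp_norm_inner_indep:
  fixes v x :: "'a \<Rightarrow> 'b::euclidean_space"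
  assumes indep: "indep_var borel v borel x"
    and "1 \<le> p" "0 \<le> c" "0 \<le> s"
    and v: "AE \<omega> in M. norm (v \<omega>) \<le> c"
    and int: "\<And>u. norm u = 1 \<Longrightarrow> integrable M (\<lambda>\<omega>. \<bar>u \<bullet> x \<omega>\<bar> powr p)"
    and le: "\<And>u. norm u = 1 \<Longrightarrow> Lp_norm M p (\<lambda>\<omega>. u \<bullet> x \<omega>) \<le> s"
  shows "integrable M (\<lambda>\<omega>. \<bar>v \<omega> \<bullet> x \<omega>\<bar> powr p)"
    and "Lp_norm M p (\<lambda>\<omega>. v \<omega> \<bullet> x \<omega>) \<le> c * s"
proof -
  have [measurable]: "v \<in> borel_measurable M" "x \<in> borel_measurable M"
    using indep by (auto dest: indep_var_rv1 indep_var_rv2)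
  interpret X: prob_space "distr M borel x" by (rule prob_space_distr) measurable
  \<comment> \<open>For a frozen \<open>w\<close>, homogeneity reduces to the unit vector in the
    direction of \<open>w\<close>; the zero vector has no direction and is treated apart.\<close>
  have slice: "(\<integral>\<^sup>+y. ennreal (\<bar>w \<bullet> y\<bar> powr p) \<partial>distr M borel x) \<le> ennreal ((norm w * s) powr p)" for w
  proof (cases "w = 0")
    case False
    then have u: "norm (w /\<^sub>R norm w) = 1" by simp
    have "(\<integral>\<^sup>+y. ennreal (\<bar>w \<bullet> y\<bar> powr p) \<partial>distr M borel x)
        = (\<integral>\<^sup>+\<omega>. ennreal (norm w powr p * \<bar>(w /\<^sub>R norm w) \<bullet> x \<omega>\<bar> powr p) \<partial>M)"
      using False
      by (subst nn_integral_distr)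
         (auto simp: powr_mult[symmetric] abs_mult mult.assoc[symmetric] intro!: nn_integral_cong)
    also have "\<dots> = ennreal (LINT \<omega>|M. norm w powr p * \<bar>(w /\<^sub>R norm w) \<bullet> x \<omega>\<bar> powr p)"
      using int[OF u] by (intro nn_integral_eq_integral) auto
    also have "\<dots> \<le> ennreal (norm w powr p * s powr p)"
      using le[OF u] assms(2,4) Lp_norm_le_iff[of p s M "\<lambda>\<omega>. (w /\<^sub>R norm w) \<bullet> x \<omega>"]
      by (intro ennreal_leI) (auto intro!: mult_left_mono)
    finally show ?thesis
      using assms by (simp add: powr_mult)
  qed (use assms in simp)
  \<comment> \<open>The computation uses nonnegative integrals, so finiteness of the moment is a
    result of it and not a prerequisite.\<close>
  have "(\<integral>\<^sup>+\<omega>. ennreal (\<bar>v \<omega> \<bullet> x \<omega>\<bar> powr p) \<partial>M)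
      = (\<integral>\<^sup>+z. ennreal (\<bar>fst z \<bullet> snd z\<bar> powr p) \<partial>distr M (borel \<Otimes>\<^sub>M borel) (\<lambda>\<omega>. (v \<omega>, x \<omega>)))"
    by (subst nn_integral_distr) auto
  also have "\<dots> = (\<integral>\<^sup>+z. ennreal (\<bar>fst z \<bullet> snd z\<bar> powr p) \<partial>(distr M borel v \<Otimes>\<^sub>M distr M borel x))"
    using indep by (simp add: indep_var_distribution_eq)
  also have "\<dots> = (\<integral>\<^sup>+w. \<integral>\<^sup>+y. ennreal (\<bar>w \<bullet> y\<bar> powr p) \<partial>distr M borel x \<partial>distr M borel v)"
    by (subst X.nn_integral_fst[symmetric]) auto
  also have "\<dots> \<le> (\<integral>\<^sup>+w. ennreal ((norm w * s) powr p) \<partial>distr M borel v)"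
    by (intro nn_integral_mono slice)
  also have "\<dots> = (\<integral>\<^sup>+\<omega>. ennreal ((norm (v \<omega>) * s) powr p) \<partial>M)"
    by (subst nn_integral_distr) auto
  also have "\<dots> \<le> (\<integral>\<^sup>+\<omega>. ennreal ((c * s) powr p) \<partial>M)"
    using v by (intro nn_integral_mono_AE)
      (auto elim!: eventually_mono intro!: ennreal_leI powr_mono2 mult_right_mono simp: assms(4) order_trans[OF zero_le_one assms(2)])
  also have "\<dots> = ennreal ((c * s) powr p)"
    by (simp add: emeasure_space_1)
  finally have nn: "(\<integral>\<^sup>+\<omega>. ennreal (\<bar>v \<omega> \<bullet> x \<omega>\<bar> powr p) \<partial>M) \<le> ennreal ((c * s) powr p)" .
  show int': "integrable M (\<lambda>\<omega>. \<bar>v \<omega> \<bullet> x \<omega>\<bar> powr p)"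
    using nn by (intro integrableI_nonneg) (auto intro: le_less_trans)
  have "ennreal (LINT \<omega>|M. \<bar>v \<omega> \<bullet> x \<omega>\<bar> powr p) \<le> ennreal ((c * s) powr p)"
    using nn by (subst (asm) nn_integral_eq_integral[OF int']) auto
  then show "Lp_norm M p (\<lambda>\<omega>. v \<omega> \<bullet> x \<omega>) \<le> c * s"
    using assms by (subst Lp_norm_le_iff) auto
qed

text \<open>Expansion in the basis reduces this to the product rule for independent integrable real
  variables, one coordinate at a time.\<close>

lemma (in prob_space) expectation_inner_indep:
  fixes v x :: "'a \<Rightarrow> 'b::euclidean_space"
  assumes indep: "indep_var borel v borel x" and "integrable M v" "integrable M x"
  shows "integrable M (\<lambda>\<omega>. v \<omega> \<bullet> x \<omega>)"
    and "(LINT \<omega>|M. v \<omega> \<bullet> x \<omega>) = (LINT \<omega>|M. v \<omega>) \<bullet> (LINT \<omega>|M. x \<omega>)"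
proof -
  have i: "indep_var borel (\<lambda>\<omega>. v \<omega> \<bullet> b) borel (\<lambda>\<omega>. x \<omega> \<bullet> b)" for b
    using indep_var_compose[OF indep, of "\<lambda>y. y \<bullet> b" borel "\<lambda>y. y \<bullet> b" borel]
    by (simp add: comp_def)
  have coord: "integrable M (\<lambda>\<omega>. v \<omega> \<bullet> b)" "integrable M (\<lambda>\<omega>. x \<omega> \<bullet> b)" for b
    using assms by auto
  have int: "integrable M (\<lambda>\<omega>. (v \<omega> \<bullet> b) * (x \<omega> \<bullet> b))" for b
    by (rule indep_var_integrable[OF i coord])
  have eq: "(\<lambda>\<omega>. v \<omega> \<bullet> x \<omega>) = (\<lambda>\<omega>. \<Sum>b\<in>Basis. (v \<omega> \<bullet> b) * (x \<omega> \<bullet> b))"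
    by (intro ext euclidean_inner)
  show "integrable M (\<lambda>\<omega>. v \<omega> \<bullet> x \<omega>)"
    unfolding eq by (intro Bochner_Integration.integrable_sum int)
  have "(LINT \<omega>|M. v \<omega> \<bullet> x \<omega>) = (\<Sum>b\<in>Basis. (LINT \<omega>|M. v \<omega> \<bullet> b) * (LINT \<omega>|M. x \<omega> \<bullet> b))"
    unfolding eq by (simp add: int indep_var_lebesgue_integral[OF i coord])
  also have "\<dots> = (LINT \<omega>|M. v \<omega>) \<bullet> (LINT \<omega>|M. x \<omega>)"
    using assms(2,3) by (subst euclidean_inner[of "expectation v" "expectation x"]) simp
  finally show "(LINT \<omega>|M. v \<omega> \<bullet> x \<omega>) = (LINT \<omega>|M. v \<omega>) \<bullet> (LINT \<omega>|M. x \<omega>)" .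
qed

text \<open>One time step seen in a fixed direction. Independence makes the mean of the inner
  product equal to the inner product of the means, which is what the splitting into a conditioned
  term and a bounded term rests on. The last conclusion serves to control the means along the
  recursion.\<close>

lemma (in prob_space) Lp_norm_inner_centered:
  fixes v x :: "'a \<Rightarrow> 'b::euclidean_space"
  assumes indep: "indep_var borel v borel x" and x: "integrable M x"
    and "1 \<le> p" "0 \<le> c" "0 \<le> s"
    and v: "AE \<omega> in M. norm (v \<omega>) \<le> c"
    and int: "\<And>u. norm u = 1 \<Longrightarrow> integrable M (\<lambda>\<omega>. \<bar>u \<bullet> (x \<omega> - expectation x)\<bar> powr p)"
    and le: "\<And>u. norm u = 1 \<Longrightarrow> Lp_norm M p (\<lambda>\<omega>. u \<bullet> (x \<omega> - expectation x)) \<le> s"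
  shows "integrable M (\<lambda>\<omega>. \<bar>v \<omega> \<bullet> x \<omega> - (LINT \<omega>|M. v \<omega> \<bullet> x \<omega>)\<bar> powr p)"
    and "Lp_norm M p (\<lambda>\<omega>. v \<omega> \<bullet> x \<omega> - (LINT \<omega>|M. v \<omega> \<bullet> x \<omega>)) \<le> c * s + 2 * c * norm (expectation x)"
    and "\<bar>LINT \<omega>|M. v \<omega> \<bullet> x \<omega>\<bar> \<le> c * norm (expectation x)"
proof -
  have [measurable]: "v \<in> borel_measurable M" "x \<in> borel_measurable M"
    using indep by (auto dest: indep_var_rv1 indep_var_rv2)
  have intv: "integrable M v"
    by (rule integrable_const_bound[OF v]) measurable
  let ?m = "expectation x" and ?w = "expectation v"
  have E: "(LINT \<omega>|M. v \<omega> \<bullet> x \<omega>) = ?w \<bullet> ?m"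
    by (rule expectation_inner_indep(2)[OF indep intv x])
  have "norm ?w \<le> (LINT \<omega>|M. norm (v \<omega>))"
    by (rule integral_norm_bound)
  also have "\<dots> \<le> (LINT \<omega>|M. c)"
    by (rule integral_mono_AE) (use intv v in auto)
  finally have w: "norm ?w \<le> c"
    by (simp add: prob_space)
  show "\<bar>LINT \<omega>|M. v \<omega> \<bullet> x \<omega>\<bar> \<le> c * norm ?m"
    unfolding E by (rule order_trans[OF Cauchy_Schwarz_ineq2 mult_right_mono[OF w]]) simp
  have rest: "AE \<omega> in M. \<bar>(v \<omega> - ?w) \<bullet> ?m\<bar> \<le> 2 * c * norm ?m"
    using v
  proof eventually_elim
    case (elim \<omega>)
    have "\<bar>(v \<omega> - ?w) \<bullet> ?m\<bar> \<le> norm (v \<omega> - ?w) * norm ?m"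
      by (rule Cauchy_Schwarz_ineq2)
    also have "norm (v \<omega> - ?w) \<le> 2 * c"
      using norm_triangle_ineq4[of "v \<omega>" ?w] elim w by simp
    finally show ?case by (simp add: mult_right_mono)
  qed
  have "indep_var borel (id \<circ> v) borel ((\<lambda>y. y - ?m) \<circ> x)"
    by (rule indep_var_compose[OF indep]) auto
  then have indep': "indep_var borel v borel (\<lambda>\<omega>. x \<omega> - ?m)"
    by (simp add: comp_def)
  note main = Lp_norm_inner_indep[OF indep' \<open>1 \<le> p\<close> \<open>0 \<le> c\<close> \<open>0 \<le> s\<close> v int le]
  have split: "v \<omega> \<bullet> x \<omega> - (LINT \<omega>|M. v \<omega> \<bullet> x \<omega>)
      = v \<omega> \<bullet> (x \<omega> - ?m) + (v \<omega> - ?w) \<bullet> ?m" for \<omega>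
    by (simp add: E inner_diff)
  show "integrable M (\<lambda>\<omega>. \<bar>v \<omega> \<bullet> x \<omega> - (LINT \<omega>|M. v \<omega> \<bullet> x \<omega>)\<bar> powr p)"
    unfolding split by (rule Lp_norm_add_bounded(1)[OF _ _ _ _ _ main rest]) (use assms in auto)
  show "Lp_norm M p (\<lambda>\<omega>. v \<omega> \<bullet> x \<omega> - (LINT \<omega>|M. v \<omega> \<bullet> x \<omega>)) \<le> c * s + 2 * c * norm ?m"
    unfolding split by (rule Lp_norm_add_bounded(2)[OF _ _ _ _ _ main rest]) (use assms in auto)
qed

section \<open>Independence of the next matrices from the past\<close>

text \<open>Closure under intersection is what allows independence to pass from these generators to
  the generated sigma-algebras.\<close>

lemma Int_stable_vimages: "Int_stable {f -` S \<inter> \<Omega> |S. S \<in> sets N}"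
proof (rule Int_stableI)
  fix a b assume "a \<in> {f -` S \<inter> \<Omega> |S. S \<in> sets N}" "b \<in> {f -` S \<inter> \<Omega> |S. S \<in> sets N}"
  then obtain S T where "S \<in> sets N" "T \<in> sets N" "a \<inter> b = f -` (S \<inter> T) \<inter> \<Omega>"
    by auto
  then show "a \<inter> b \<in> {f -` S \<inter> \<Omega> |S. S \<in> sets N}"
    by blast
qed

text \<open>Merges the two independence hypotheses into one family with \<open>X\<close> at index 0:
  the event of \<open>X\<close> splits off because \<open>X\<close> is independent of the whole
  process, and the other events factor by mutual independence. Families of sets are used because
  \<open>X\<close> and \<open>Z\<close> take values in different types.\<close>

lemma (in prob_space) indep_sets_initial_and_seq:
  fixes X :: "'a \<Rightarrow> 'b::topological_space" and Z :: "nat \<Rightarrow> 'a \<Rightarrow> 'c::topological_space"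
  assumes X: "X \<in> borel_measurable M"
    and Z: "indep_vars (\<lambda>_. borel) Z {1..}"
    and XZ: "indep_of_seq M X Z"
  shows "indep_sets (case_nat {X -` S \<inter> space M |S. S \<in> sets borel}
      (\<lambda>j. {Z (Suc j) -` S \<inter> space M |S. S \<in> sets borel})) UNIV"
    (is "indep_sets ?G UNIV")
proof (rule indep_setsI)
  have Zm: "random_variable borel (Z j)" if "1 \<le> j" for j
    using Z that by (auto simp: indep_vars_def2)
  show "?G i \<subseteq> events" for i
    by (cases i) (use X Zm in \<open>auto intro: measurable_sets\<close>)
  fix F J assume J: "J \<noteq> {}" "finite J" and F: "\<forall>j\<in>J. F j \<in> ?G j"
  have FZ: "F j \<in> {Z j -` S \<inter> space M |S. S \<in> sets borel}" if "j \<in> J" "j \<noteq> 0" for j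
    using bspec[OF F that(1)] that(2) by (cases j) auto
  have prod: "prob (\<Inter>j\<in>J'. F j) = (\<Prod>j\<in>J'. prob (F j))"
    if "J' \<subseteq> J" "0 \<notin> J'" "J' \<noteq> {}" for J'
  proof (rule indep_setsD)
    show "indep_sets (\<lambda>i. {Z i -` S \<inter> space M |S. S \<in> sets borel}) {1..}"
      using Z by (simp add: indep_vars_def2)
    have "F j \<in> {Z j -` S \<inter> space M |S. S \<in> sets borel}" if j: "j \<in> J'" for j
    proof -
      have "j \<noteq> 0" "j \<in> J"
        using j \<open>J' \<subseteq> J\<close> \<open>0 \<notin> J'\<close> by (metis, blast)
      then show ?thesis
        by (intro FZ)
    qed
    then show "\<forall>j\<in>J'. F j \<in> {Z j -` S \<inter> space M |S. S \<in> sets borel}"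
      by blast
    show "J' \<subseteq> {1..}"
    proof
      fix j assume "j \<in> J'"
      then have "j \<noteq> 0" using that(2) by metis
      then show "j \<in> {1..}" by simp
    qed
    show "finite J'" "J' \<noteq> {}"
      using that J finite_subset by auto
  qed
  show "prob (\<Inter>j\<in>J. F j) = (\<Prod>j\<in>J. prob (F j))"
  \<comment> \<open>Both hypotheses are needed together only if index 0 occurs next to some other
    index.\<close>
  proof (cases "0 \<in> J \<and> J - {0} \<noteq> {}")
    case True
    let ?V = "vimage_algebra (space M) (\<lambda>\<omega>. \<lambda>t\<in>{1..}. Z t \<omega>) (PiM {1..} (\<lambda>_. borel))"
    have "F j \<in> sets ?V" if j: "j \<in> J - {0}" for j
    proof -
      have j1: "j \<in> {1..}"
        using j by auto
      have "F j \<in> {Z j -` S \<inter> space M |S. S \<in> sets borel}"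
        using j by (intro FZ) auto
      then obtain S where S: "S \<in> sets borel" "F j = Z j -` S \<inter> space M"
        by blast
      \<comment> \<open>A cylinder set over coordinate \<open>j\<close>: its preimage under the
        whole process is the event \<open>F j\<close>.\<close>
      let ?S = "(\<lambda>f. f j) -` S \<inter> space (PiM {1..} (\<lambda>_. borel :: 'c measure))"
      have "?S \<in> sets (PiM {1..} (\<lambda>_. borel))"
        using measurable_component_singleton[OF j1] S(1) by (rule measurable_sets)
      then have "(\<lambda>\<omega>. \<lambda>t\<in>{1..}. Z t \<omega>) -` ?S \<inter> space M \<in> sets ?V"
        by (rule in_vimage_algebra)
      moreover have "(\<lambda>\<omega>. \<lambda>t\<in>{1..}. Z t \<omega>) -` ?S \<inter> space M = F j"
        using j1 S(2) by (auto simp: space_PiM)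
      ultimately show ?thesis by simp
    qed
    then have "(\<Inter>j\<in>J - {0}. F j) \<in> sets ?V"
      using True J by (intro sets.finite_INT) auto
    moreover have "F 0 \<in> sets (vimage_algebra (space M) X borel)"
      using F True by (auto simp: in_vimage_algebra dest!: bspec[of _ _ 0])
    ultimately have "prob (F 0 \<inter> (\<Inter>j\<in>J - {0}. F j)) = prob (F 0) * prob (\<Inter>j\<in>J - {0}. F j)"
      using indep_setD[OF XZ[unfolded indep_of_seq_def]] by blast
    also have "F 0 \<inter> (\<Inter>j\<in>J - {0}. F j) = (\<Inter>j\<in>J. F j)"
      using True by auto
    finally show ?thesis
      using True J prod[of "J - {0}"] by (simp add: prod.remove[of J 0])
  next
    case False
    \<comment> \<open>Here either \<open>J\<close> avoids 0, or \<open>J = {0}\<close> and the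
      product has a single factor.\<close>
    then show ?thesis
      using prod[of J] J by (cases "0 \<in> J") (auto simp: subset_singleton_iff)
  qed
qed

text \<open>The index blocks \<open>{Suc t}\<close> and \<open>{..t}\<close> are disjoint, so they
  generate independent sigma-algebras; one carries \<open>h (Z (Suc t))\<close>, the other
  \<open>Y\<close>. Later \<open>Y\<close> is the state at time \<open>t\<close> and
  \<open>h\<close> yields the random direction.\<close>

lemma (in prob_space) indep_var_next_past:
  fixes Z :: "nat \<Rightarrow> 'a \<Rightarrow> 'c::topological_space" and E :: "nat \<Rightarrow> 'a set set"
  assumes E: "indep_sets E UNIV" "\<And>i. Int_stable (E i)"
    and ES: "E (Suc t) = {Z (Suc t) -` S \<inter> space M |S. S \<in> sets borel}"
    and h: "h \<in> measurable borel N'"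
    and Zm: "Z (Suc t) \<in> borel_measurable M"
    and Y: "Y \<in> measurable (sigma (space M) (\<Union>i\<le>t. E i)) N"
  shows "indep_var N' (\<lambda>\<omega>. h (Z (Suc t) \<omega>)) N Y"
proof -
  let ?P = "sigma_sets (space M) (\<Union>i\<in>{..t}. E i)"
  have ev: "E i \<subseteq> events" for i
    using E(1) by (auto simp: indep_sets_def)
  then have sub: "(\<Union>i\<in>{..t}. E i) \<subseteq> Pow (space M)"
    using sets.sets_into_space by blast
  have "sigma_sets (space M) (\<Union>i\<in>{..t}. E i) \<subseteq> events"
    using ev by (intro sets.sigma_sets_subset) auto
  then have Y': "random_variable N Y"
    using Y sub by (auto simp: measurable_def)
  have hZ: "random_variable N' (\<lambda>\<omega>. h (Z (Suc t) \<omega>))"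
    by (rule measurable_compose[OF Zm h])
  \<comment> \<open>The two blocks are indexed by \<open>bool\<close>, in the form that
    \<open>indep_set\<close> unfolds to.\<close>
  have "indep_sets (\<lambda>j. sigma_sets (space M) (\<Union>i\<in>case_bool {Suc t} {..t} j. E i)) UNIV"
  proof (rule indep_sets_collect_sigma)
    show "indep_sets E (\<Union>j\<in>UNIV. case_bool {Suc t} {..t} j)"
      by (rule indep_sets_mono_index[OF _ E(1)]) simp
    show "disjoint_family (case_bool {Suc t} {..t})"
      by (auto simp: disjoint_family_on_def split: bool.split)
  qed (rule E(2))
  also have "(\<lambda>j. sigma_sets (space M) (\<Union>i\<in>case_bool {Suc t} {..t} j. E i))
      = case_bool (sigma_sets (space M) (E (Suc t))) ?P"
    by (rule ext) (simp split: bool.split)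
  finally have ind: "indep_set (sigma_sets (space M) (E (Suc t))) ?P"
    by (simp add: indep_set_def)
  have sub1: "sigma_sets (space M) {(\<lambda>\<omega>. h (Z (Suc t) \<omega>)) -` S \<inter> space M |S. S \<in> sets N'}
      \<subseteq> sigma_sets (space M) (E (Suc t))"
  proof (rule sigma_sets_subseteq, safe)
    fix S assume "S \<in> sets N'"
    then have "h -` S \<in> sets borel"
      using measurable_sets[OF h] by simp
    moreover have "(\<lambda>\<omega>. h (Z (Suc t) \<omega>)) -` S = Z (Suc t) -` (h -` S)"
      by auto
    ultimately show "(\<lambda>\<omega>. h (Z (Suc t) \<omega>)) -` S \<inter> space M \<in> E (Suc t)"
      unfolding ES by blast
  qed
  have sub2: "sigma_sets (space M) {Y -` S \<inter> space M |S. S \<in> sets N} \<subseteq> ?P"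
    using measurable_sets[OF Y] sub by (intro sigma_sets_mono) auto
  show ?thesis
    unfolding indep_var_eq indep_sets2_eq
  proof (intro conjI hZ Y' ballI)
    show "sigma_sets (space M) {(\<lambda>\<omega>. h (Z (Suc t) \<omega>)) -` S \<inter> space M |S. S \<in> sets N'} \<subseteq> events"
      using sub1 indep_setD_ev1[OF ind] by blast
    show "sigma_sets (space M) {Y -` S \<inter> space M |S. S \<in> sets N} \<subseteq> events"
      using sub2 indep_setD_ev2[OF ind] by blast
  qed (use sub1 sub2 indep_setD[OF ind] in blast)
qed

section \<open>Operator norm, continuity of matrix operations, transposes\<close>

lemma norm_matrix_vector_mult_le_opnorm: "norm (C *v x) \<le> opnorm C * norm x"
  for C :: "real^'n^'m"
  unfolding opnorm_def by (rule onorm[OF matrix_vector_mul_bounded_linear])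

lemma opnorm_nonneg: "0 \<le> opnorm C"
  for C :: "real^'n^'m"
  unfolding opnorm_def by (rule onorm_pos_le[OF matrix_vector_mul_bounded_linear])

lemma opnorm_le_iff: "opnorm C \<le> k \<longleftrightarrow> (\<forall>x. norm (C *v x) \<le> k * norm x)"
  for C :: "real^'n^'m"
proof
  assume "opnorm C \<le> k"
  then show "\<forall>x. norm (C *v x) \<le> k * norm x"
    by (meson norm_matrix_vector_mult_le_opnorm mult_right_mono norm_ge_zero order_trans)
next
  assume "\<forall>x. norm (C *v x) \<le> k * norm x"
  then show "opnorm C \<le> k"
    unfolding opnorm_def by (intro onorm_le) blast
qed

lemma continuous_on_matrix_vector_mult [continuous_intros]:
  fixes f :: "'a::topological_space \<Rightarrow> real^'n^'m"
  assumes "continuous_on S f" "continuous_on S g"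
  shows "continuous_on S (\<lambda>x. f x *v g x)"
  unfolding matrix_vector_mult_def by (intro continuous_intros assms)

lemma continuous_on_matrix_mult [continuous_intros]:
  fixes f :: "'a::topological_space \<Rightarrow> real^'n^'m" and g :: "'a \<Rightarrow> real^'k^'n"
  assumes "continuous_on S f" "continuous_on S g"
  shows "continuous_on S (\<lambda>x. f x ** g x)"
  unfolding matrix_matrix_mult_def by (intro continuous_intros assms)

lemma continuous_on_matrix_transpose [continuous_intros]:
  fixes f :: "'a::topological_space \<Rightarrow> real^'n^'m"
  assumes "continuous_on S f"
  shows "continuous_on S (\<lambda>x. transpose (f x))"
  unfolding transpose_def by (intro continuous_intros assms)

text \<open>An intersection of closed conditions, one for each vector. It makes a norm bound a Borel
  event, which can then be transported between equal distributions.\<close>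

lemma closed_opnorm_le:
  fixes f :: "'a::topological_space \<Rightarrow> real^'n^'m"
  assumes "continuous_on UNIV f"
  shows "closed {z. opnorm (f z) \<le> k}"
  unfolding opnorm_le_iff
  by (intro closed_Collect_all closed_Collect_le continuous_intros assms)

lemma inner_matrix_vector_mult: "u \<bullet> (C *v x) = (transpose C *v u) \<bullet> x"
  for C :: "real^'n^'m"
  by (metis dot_lmul_matrix vector_transpose_matrix transpose_transpose)

text \<open>With \<open>v = transpose C *v u\<close>, the square of the norm of \<open>v\<close>
  equals \<open>u \<bullet> (C *v v)\<close>; Cauchy-Schwarz and cancelling one factor
  \<open>norm v\<close> give the bound.\<close>

lemma norm_transpose_matrix_vector_le:
  fixes C :: "real^'n^'m"
  assumes "0 \<le> c" "\<And>x. norm (C *v x) \<le> c * norm x"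
  shows "norm (transpose C *v u) \<le> c * norm u"
proof (cases "transpose C *v u = 0")
  case True
  with \<open>0 \<le> c\<close> show ?thesis by simp
next
  case False
  let ?v = "transpose C *v u"
  have "norm ?v * norm ?v = u \<bullet> (C *v ?v)"
    by (simp add: inner_matrix_vector_mult dot_square_norm power2_eq_square)
  also have "\<dots> \<le> norm u * (c * norm ?v)"
    by (rule order_trans[OF norm_cauchy_schwarz mult_left_mono[OF assms(2)]]) simp
  finally have "norm ?v * norm ?v \<le> (c * norm u) * norm ?v"
    by (simp add: mult_ac)
  with False show ?thesis by simp
qed

section \<open>Sub-Gaussian vectors under an independent bounded random matrix\<close>

text \<open>Test with exponent 1 and one coordinate vector; \<open>undefined\<close> is merely some
  index, available because index types are nonempty.\<close>

lemma sub_gaussian_nonneg: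
  fixes X :: "'w \<Rightarrow> real^'n"
  assumes "sub_gaussian M X \<sigma>"
  shows "0 \<le> \<sigma>"
proof -
  have "norm (axis undefined 1 :: real^'n) = 1"
    by simp
  then have "Lp_norm M 1 (\<lambda>\<omega>. axis undefined 1 \<bullet> (X \<omega> - (LINT \<omega>'|M. X \<omega>'))) \<le> \<sigma> * sqrt 1"
    using assms unfolding sub_gaussian_def by blast
  from order_trans[OF _ this, of 0] show ?thesis
    by (simp add: Lp_norm_def)
qed

lemma sub_gaussian_mono:
  assumes "sub_gaussian M X \<sigma>" "\<sigma> \<le> \<tau>"
  shows "sub_gaussian M X \<tau>"
proof -
  have "\<sigma> * sqrt p \<le> \<tau> * sqrt p" if "1 \<le> p" for p
    using assms(2) that by (intro mult_right_mono) auto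
  with assms(1) show ?thesis
    unfolding sub_gaussian_def by (blast intro: order_trans)
qed

text \<open>One step of the state recursion. Moving \<open>C\<close> across the inner product turns
  each direction \<open>u\<close> into the random direction
  \<open>transpose (C \<omega>) *v u\<close>, of norm at most \<open>c\<close>.\<close>

lemma (in prob_space) sub_gaussian_random_matrix_mult:
  fixes C :: "'a \<Rightarrow> real^'n^'k" and Y :: "'a \<Rightarrow> real^'n"
  assumes subg: "sub_gaussian M Y s" and Y: "integrable M Y"
    and meas: "(\<lambda>\<omega>. C \<omega> *v Y \<omega>) \<in> borel_measurable M"
    and indep: "\<And>u. indep_var borel (\<lambda>\<omega>. transpose (C \<omega>) *v u) borel Y"
    and "0 \<le> c" and C: "AE \<omega> in M. \<forall>x. norm (C \<omega> *v x) \<le> c * norm x"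
  shows "integrable M (\<lambda>\<omega>. C \<omega> *v Y \<omega>)"
    and "norm (LINT \<omega>|M. C \<omega> *v Y \<omega>) \<le> c * norm (expectation Y)"
    and "sub_gaussian M (\<lambda>\<omega>. C \<omega> *v Y \<omega>) (c * (s + 2 * norm (expectation Y)))"
proof -
  note s = sub_gaussian_nonneg[OF subg]
  let ?W = "\<lambda>\<omega>. C \<omega> *v Y \<omega>"
  show W: "integrable M ?W"
  proof (rule Bochner_Integration.integrable_bound[OF _ meas])
    show "integrable M (\<lambda>\<omega>. c * norm (Y \<omega>))"
      using Y by simp
    show "AE \<omega> in M. norm (?W \<omega>) \<le> norm (c * norm (Y \<omega>))"
      using C \<open>0 \<le> c\<close> by (auto elim!: eventually_mono)
  qed
  have v: "AE \<omega> in M. norm (transpose (C \<omega>) *v u) \<le> c" if "norm u = 1" for u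
    using C
  proof eventually_elim
    case (elim \<omega>)
    show ?case
      using norm_transpose_matrix_vector_le[of c "C \<omega>" u] elim that \<open>0 \<le> c\<close> by simp
  qed
  have inner: "u \<bullet> (?W \<omega> - expectation ?W)
      = (transpose (C \<omega>) *v u) \<bullet> Y \<omega> - (LINT \<omega>|M. (transpose (C \<omega>) *v u) \<bullet> Y \<omega>)" for u \<omega>
    using W by (simp only: inner_diff_right inner_matrix_vector_mult[symmetric] integral_inner_right)
  have Yp: "integrable M (\<lambda>\<omega>. \<bar>u \<bullet> (Y \<omega> - expectation Y)\<bar> powr p)"
    "Lp_norm M p (\<lambda>\<omega>. u \<bullet> (Y \<omega> - expectation Y)) \<le> s * sqrt p"
    if "norm u = 1" "1 \<le> p" for u p
    using subg that unfolding sub_gaussian_def by auto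
  have sp: "0 \<le> s * sqrt p" if "1 \<le> p" for p
    using s that by simp
  note main = Lp_norm_inner_centered[OF indep Y _ \<open>0 \<le> c\<close> sp v Yp]
  show "norm (expectation ?W) \<le> c * norm (expectation Y)"
  proof (cases "expectation ?W = 0")
    case False
    \<comment> \<open>The norm of the mean is recovered by testing in its own direction.\<close>
    let ?u = "expectation ?W /\<^sub>R norm (expectation ?W)"
    have "norm (expectation ?W) = ?u \<bullet> expectation ?W"
      using False by (simp add: dot_square_norm power2_eq_square)
    also have "\<dots> = (LINT \<omega>|M. (transpose (C \<omega>) *v ?u) \<bullet> Y \<omega>)"
      using W by (simp only: inner_matrix_vector_mult[symmetric] integral_inner_right)
    also have "\<dots> \<le> c * norm (expectation Y)"
      \<comment> \<open>The bound on the mean is the same for every exponent; 1 is chosen.\<close>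
      using main(3)[of 1 ?u] False by simp
    finally show ?thesis .
  qed (use \<open>0 \<le> c\<close> in simp)
  show "sub_gaussian M ?W (c * (s + 2 * norm (expectation Y)))"
    unfolding sub_gaussian_def inner
  proof (intro conjI allI impI)
    fix u :: "real^'k" and p :: real
    assume u: "norm u = 1" and p: "1 \<le> p"
    show "integrable M (\<lambda>\<omega>. \<bar>(transpose (C \<omega>) *v u) \<bullet> Y \<omega> - (LINT \<omega>|M. (transpose (C \<omega>) *v u) \<bullet> Y \<omega>)\<bar> powr p)"
      by (rule main(1)) (use u p in auto)
    have "Lp_norm M p (\<lambda>\<omega>. (transpose (C \<omega>) *v u) \<bullet> Y \<omega> - (LINT \<omega>|M. (transpose (C \<omega>) *v u) \<bullet> Y \<omega>))
        \<le> c * (s * sqrt p) + 2 * c * norm (expectation Y)"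
      by (rule main(2)) (use u p in auto)
    \<comment> \<open>Since \<open>sqrt p\<close> is at least 1, the constant term can be absorbed
      into the sub-Gaussian form.\<close>
    also have "2 * c * norm (expectation Y) \<le> 2 * c * norm (expectation Y) * sqrt p"
      using mult_left_mono[of 1 "sqrt p" "2 * c * norm (expectation Y)"] p \<open>0 \<le> c\<close> by simp
    finally show "Lp_norm M p (\<lambda>\<omega>. (transpose (C \<omega>) *v u) \<bullet> Y \<omega> - (LINT \<omega>|M. (transpose (C \<omega>) *v u) \<bullet> Y \<omega>))
        \<le> c * (s + 2 * norm (expectation Y)) * sqrt p"
      by (simp add: algebra_simps)
  qed (rule meas)
qed

section \<open>The closed loop and the induction over time\<close>

lemma norm_closed_loop_le:
  fixes A :: "real^'n^'n" and B :: "real^'m^'n" and L :: "real^'n^'m"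
  assumes "opnorm A \<le> K" "opnorm B \<le> K"
  shows "norm ((A - B ** L) *v x) \<le> K * (1 + opnorm L) * norm x"
proof -
  have "0 \<le> K"
    using opnorm_nonneg[of A] assms by linarith
  have "norm ((A - B ** L) *v x) \<le> norm (A *v x) + norm (B *v (L *v x))"
    by (simp add: matrix_vector_mult_diff_rdistrib matrix_vector_mul_assoc norm_triangle_ineq4)
  also have "norm (A *v x) \<le> K * norm x"
    using assms opnorm_le_iff by blast
  also have "norm (B *v (L *v x)) \<le> K * norm (L *v x)"
    using assms opnorm_le_iff by blast
  also have "K * norm (L *v x) \<le> K * (opnorm L * norm x)"
    using \<open>0 \<le> K\<close> by (intro mult_left_mono norm_matrix_vector_mult_le_opnorm)
  finally show ?thesis
    by (simp add: algebra_simps)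
qed

theorem lemma5p4:
  fixes M :: "'w measure"
    and A :: "nat \<Rightarrow> 'w \<Rightarrow> real^'n^'n" and B :: "nat \<Rightarrow> 'w \<Rightarrow> real^'m^'n"
    and Q :: "nat \<Rightarrow> 'w \<Rightarrow> real^'n^'n" and R :: "nat \<Rightarrow> 'w \<Rightarrow> real^'m^'m"
    and x0 :: "'w \<Rightarrow> real^'n" and L :: "real^'n^'m" and K \<sigma>\<^sub>0 :: real
  assumes "prob_space M"
    and "iid_seq M (\<lambda>t \<omega>. (A t \<omega>, B t \<omega>, Q t \<omega>, R t \<omega>))"
    and "\<And>t. t \<ge> 1 \<Longrightarrow> AE \<omega> in M. psd (Q t \<omega>) \<and> psd (R t \<omega>)"
    and "x0 \<in> borel_measurable M"
    and "indep_of_seq M x0 (\<lambda>t \<omega>. (A t \<omega>, B t \<omega>, Q t \<omega>, R t \<omega>))"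
    and "integrable M (\<lambda>\<omega>. (norm (x0 \<omega>))\<^sup>2)"
    and "integrable M (\<lambda>\<omega>. (opnorm (A 1 \<omega>))\<^sup>2)"
    and "integrable M (\<lambda>\<omega>. (opnorm (B 1 \<omega>))\<^sup>2)"
    and "integrable M (\<lambda>\<omega>. opnorm (Q 1 \<omega>))"
    and "integrable M (\<lambda>\<omega>. opnorm (R 1 \<omega>))"
    and "pos_def (LINT \<omega>|M. Q 1 \<omega>)"
    and "pos_def (LINT \<omega>|M. R 1 \<omega>)"
    and "pos_def (LINT \<omega>|M. outer (x0 \<omega>))"
    and "U_ad M (A 1) (B 1) \<noteq> {}"
    and "sub_gaussian M x0 \<sigma>\<^sub>0"
    and "K > 0"
    and "AE \<omega> in M. Max {opnorm (A 1 \<omega>), opnorm (B 1 \<omega>), opnorm (Q 1 \<omega>), opnorm (R 1 \<omega>)} \<le> K"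
    and "L \<in> U_ad M (A 1) (B 1)"
  shows "\<forall>t. sub_gaussian M (state A B L x0 t)
           ((4 * K * (1 + opnorm L)) ^ t * (\<sigma>\<^sub>0 + 2 * norm (LINT \<omega>|M. x0 \<omega>)))"
proof -
  interpret prob_space M by fact
  let ?Z = "\<lambda>t \<omega>. (A t \<omega>, B t \<omega>, Q t \<omega>, R t \<omega>)"
  let ?c = "K * (1 + opnorm L)"
  let ?m = "norm (LINT \<omega>|M. x0 \<omega>)"
  let ?C = "\<lambda>z::(real^'n^'n) \<times> (real^'m^'n) \<times> (real^'n^'n) \<times> (real^'m^'m). fst z - fst (snd z) ** L"
  let ?x = "state A B L x0"
  define E where "E = case_nat {x0 -` S \<inter> space M |S. S \<in> sets borel}
      (\<lambda>j. {?Z (Suc j) -` S \<inter> space M |S. S \<in> sets borel})"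
  have c: "0 \<le> ?c"
    using \<open>K > 0\<close> opnorm_nonneg[of L] by simp
  have Zind: "indep_vars (\<lambda>_. borel) ?Z {1..}"
    using assms(2) by (simp add: iid_seq_def)
  have Zm: "?Z t \<in> borel_measurable M" if "1 \<le> t" for t
    using Zind that by (auto simp: indep_vars_def2)
  have Zd: "distr M borel (?Z t) = distr M borel (?Z 1)" if "1 \<le> t" for t
    using assms(2) that unfolding iid_seq_def by blast
  have E: "indep_sets E UNIV"
    unfolding E_def by (rule indep_sets_initial_and_seq[OF assms(4) Zind assms(5)])
  have stable: "Int_stable (E i)" for i
    by (cases i) (simp_all add: E_def Int_stable_vimages)
  have "E i \<subseteq> events" for i
    using E by (simp add: indep_sets_def)
  then have Epow: "(\<Union>i\<le>t. E i) \<subseteq> Pow (space M)" for t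
    using sets.sets_into_space by blast
  \<comment> \<open>The natural filtration: index 0 contributes the initial state, index
    \<open>Suc j\<close> the matrices of that time.\<close>
  let ?F = "\<lambda>t. sigma (space M) (\<Union>i\<le>t. E i)"
  have EF: "f \<in> borel_measurable (?F t)"
    if "i \<le> t" "{f -` S \<inter> space M |S. S \<in> sets borel} \<subseteq> E i" for f :: "'w \<Rightarrow> 'd::topological_space" and i t
  proof (rule measurableI)
    fix S :: "'d set" assume "S \<in> sets borel"
    then show "f -` S \<inter> space (?F t) \<in> sets (?F t)"
      using that Epow by (auto intro!: sigma_sets.Basic)
  qed simp
  \<comment> \<open>\<open>N\<close> is kept arbitrary because this is applied both to the
    filtration and to \<open>M\<close>.\<close>
  have loop_measurable: "(\<lambda>\<omega>. ?C (f \<omega>) *v g \<omega>) \<in> borel_measurable N"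
    if "f \<in> borel_measurable N" "g \<in> borel_measurable N" for f g and N :: "'w measure"
    by (rule borel_measurable_continuous_Pair[OF that, where H = "\<lambda>z y. ?C z *v y"])
      (intro continuous_intros)
  \<comment> \<open>Adaptedness of the state, which makes it independent of the matrices at time
    \<open>Suc t\<close>.\<close>
  have xF: "?x t \<in> borel_measurable (?F t)" for t
  proof (induction t)
    case 0
    show ?case
      unfolding state.simps by (rule EF[of 0]) (auto simp: E_def)
  next
    case (Suc t)
    have "?x t \<in> borel_measurable (?F (Suc t))"
      using Suc measurable_mono1[OF Epow[of "Suc t"], of "\<Union>i\<le>t. E i"] by force
    moreover have "?Z (Suc t) \<in> borel_measurable (?F (Suc t))"
      by (rule EF[of "Suc t"]) (auto simp: E_def)
    ultimately have "(\<lambda>\<omega>. ?C (?Z (Suc t) \<omega>) *v ?x t \<omega>) \<in> borel_measurable (?F (Suc t))"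
      by (intro loop_measurable)
    then show ?case by simp
  qed
  \<comment> \<open>The almost sure bound is assumed at time 1 and carried to time \<open>t\<close>
    by equality of the distributions.\<close>
  have bound: "AE \<omega> in M. opnorm (A t \<omega>) \<le> K \<and> opnorm (B t \<omega>) \<le> K" if "1 \<le> t" for t
  proof -
    let ?P = "\<lambda>z::(real^'n^'n) \<times> (real^'m^'n) \<times> (real^'n^'n) \<times> (real^'m^'m).
      opnorm (fst z) \<le> K \<and> opnorm (fst (snd z)) \<le> K"
    have P: "{z \<in> space borel. ?P z} \<in> sets borel"
      by (simp, intro borel_closed closed_Collect_conj closed_opnorm_le continuous_intros)
    have "AE \<omega> in M. ?P (?Z 1 \<omega>)"
      using assms(17) by (auto elim!: eventually_mono)
    then have "AE z in distr M borel (?Z 1). ?P z"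
      by (subst AE_distr_iff[OF Zm P]) auto
    then have "AE z in distr M borel (?Z t). ?P z"
      unfolding Zd[OF that] .
    then show ?thesis
      by (subst (asm) AE_distr_iff[OF Zm[OF that] P]) auto
  qed
  have "integrable M (\<lambda>\<omega>. norm (x0 \<omega>))"
    by (rule square_integrable_imp_integrable) (use assms(4,6) in simp_all)
  then have x0: "integrable M x0"
    using assms(4) by (simp add: integrable_norm_iff)
  \<comment> \<open>Each step adds \<open>2 * ?c\<close> times the norm of the current mean, which
    is at most \<open>?c ^ t * ?m\<close>; hence the mean bound is part of the induction and the
    extra term grows linearly in \<open>t\<close>.\<close>
  have main: "integrable M (?x t) \<and> norm (expectation (?x t)) \<le> ?c ^ t * ?m
      \<and> sub_gaussian M (?x t) (?c ^ t * (\<sigma>\<^sub>0 + 2 * real t * ?m))" for t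
  proof (induct t)
    case 0
    then show ?case using x0 assms(15) by simp
  next
    case (Suc t)
    let ?D = "\<lambda>\<omega>. ?C (?Z (Suc t) \<omega>)"
    have step: "?x (Suc t) = (\<lambda>\<omega>. ?D \<omega> *v ?x t \<omega>)"
      by simp
    have indep: "indep_var borel (\<lambda>\<omega>. transpose (?D \<omega>) *v u) borel (?x t)" for u
    proof (rule indep_var_next_past[where h = "\<lambda>z. transpose (?C z) *v u", OF E stable _ _ Zm xF])
      show "(\<lambda>z. transpose (?C z) *v u) \<in> borel_measurable borel"
        by (intro borel_measurable_continuous_onI continuous_intros)
    qed (auto simp: E_def)
    have "1 \<le> Suc t"
      by simp
    from bound[OF this] have D: "AE \<omega> in M. \<forall>y. norm (?D \<omega> *v y) \<le> ?c * norm y"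
      by (rule eventually_mono) (simp add: norm_closed_loop_le)
    from Suc have IH: "integrable M (?x t)" "norm (expectation (?x t)) \<le> ?c ^ t * ?m"
      "sub_gaussian M (?x t) (?c ^ t * (\<sigma>\<^sub>0 + 2 * real t * ?m))"
      by simp_all
    have meas: "(\<lambda>\<omega>. ?D \<omega> *v ?x t \<omega>) \<in> borel_measurable M"
      by (rule loop_measurable[OF Zm borel_measurable_integrable[OF IH(1)]]) simp
    note new = sub_gaussian_random_matrix_mult[OF IH(3,1) meas indep c D]
    have "norm (expectation (?x (Suc t))) \<le> ?c * norm (expectation (?x t))"
      unfolding step by (rule new(2))
    also have "\<dots> \<le> ?c * (?c ^ t * ?m)"
      using IH(2) c by (intro mult_left_mono) auto
    finally have mean: "norm (expectation (?x (Suc t))) \<le> ?c ^ Suc t * ?m"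
      by (simp add: mult_ac)
    have "?c * (?c ^ t * (\<sigma>\<^sub>0 + 2 * real t * ?m) + 2 * norm (expectation (?x t)))
        \<le> ?c * (?c ^ t * (\<sigma>\<^sub>0 + 2 * real t * ?m) + 2 * (?c ^ t * ?m))"
      using IH(2) c by (intro mult_left_mono add_left_mono) auto
    also have "\<dots> = ?c ^ Suc t * (\<sigma>\<^sub>0 + 2 * real (Suc t) * ?m)"
      by (simp add: algebra_simps)
    finally have "sub_gaussian M (?x (Suc t)) (?c ^ Suc t * (\<sigma>\<^sub>0 + 2 * real (Suc t) * ?m))"
      unfolding step by (rule sub_gaussian_mono[OF new(3)])
    with mean show ?case
      using new(1) unfolding step by blast
  qed
  show ?thesis
  proof
    fix t
    have \<sigma>: "0 \<le> \<sigma>\<^sub>0"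
      by (rule sub_gaussian_nonneg[OF assms(15)])
    have "1 \<le> (4::real) ^ t"
      by simp
    \<comment> \<open>The factor \<open>4 ^ t\<close> of the claim dominates both the linear factor
      \<open>t\<close> and, as \<open>\<sigma>\<^sub>0\<close> is nonnegative, the coefficient 1 of
      \<open>\<sigma>\<^sub>0\<close>.\<close>
    have "t < 4 ^ t"
      by (rule power_gt_expt) simp
    then have "real t \<le> 4 ^ t"
      by (metis of_nat_less_iff of_nat_numeral of_nat_power less_imp_le)
    then have "\<sigma>\<^sub>0 + 2 * real t * ?m \<le> 4 ^ t * \<sigma>\<^sub>0 + 4 ^ t * (2 * ?m)"
      using \<open>1 \<le> 4 ^ t\<close> \<sigma> mult_right_mono[of 1 "4 ^ t" \<sigma>\<^sub>0] mult_right_mono[of "real t" "4 ^ t" "2 * ?m"]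
      by simp
    then have "?c ^ t * (\<sigma>\<^sub>0 + 2 * real t * ?m) \<le> ?c ^ t * (4 ^ t * (\<sigma>\<^sub>0 + 2 * ?m))"
      using c by (intro mult_left_mono) (auto simp: distrib_left)
    also have "\<dots> = (4 * K * (1 + opnorm L)) ^ t * (\<sigma>\<^sub>0 + 2 * ?m)"
      by (simp only: power_mult_distrib mult_ac)
    finally show "sub_gaussian M (?x t) ((4 * K * (1 + opnorm L)) ^ t * (\<sigma>\<^sub>0 + 2 * ?m))"
      using main[of t] sub_gaussian_mono by blast
  qed
qed

end
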